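(* Let $(X,\|\cdot\|)$ be a Banach space. Then the class $\mathcal{C}_{AC}(X)$ of all almost contractions $T:X\to X$ is an unsaturated class of mappings, i.e. the inclusion $\mathcal{C}_{AC}(X)\subset \mathcal{C}_{AC}^{e}(X)$ is strict.
   Context: For a self mapping $T:X\to X$ of a linear normed space $(X,\|\cdot\|)$ and $\lambda\in(0,1]$, the averaged mapping $T_\lambda:X\to X$ is $T_\lambda x=(1-\lambda)x+\lambda Tx$. If $\mathcal{C}$ is a subset of the family of all self mappings of $X$, a mapping $T:X\to X$ is called $\mathcal{C}$-enriched if there exists $\lambda\in(0,1]$ such that $T_\lambda\in\mathcal{C}$; $\mathcal{C}^{e}$ denotes the set of all $\mathcal{C}$-enriched mappings. One always has $\mathcal{C}\subseteq\mathcal{C}^{e}$ (take $\lambda=1$). The class $\mathcal{C}$ is called unsaturated if the inclusion $\mathcal{C}\subset\mathcal{C}^{e}$ is strict, and saturated if $\mathcal{C}=\mathcal{C}^{e}$. A mapping $T:X\to X$ is an almost contraction if there exist constants $\delta\in(0,1)$ and $L\ge 0$ such that $\|Tx-Ty\|\le \delta\,\|x-y\|+L\,\|y-Tx\|$ for all $x,y\in X$. $\mathcal{C}_{AC}(X)$ denotes the class of all almost contractions on $X$, and $\mathcal{C}_{AC}^{e}(X)=(\mathcal{C}_{AC}(X))^{e}$.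
   Formalization: The Banach space X is assumed to be different from {0}; on the zero space the only self mapping is an almost contraction, so the inclusion is an equality and the claim fails. *)

theory Defs
  imports Complex_Main
begin

definition averaged :: "real \<Rightarrow> ('a::real_normed_vector \<Rightarrow> 'a) \<Rightarrow> 'a \<Rightarrow> 'a" where
  "averaged lam T x = (1 - lam) *\<^sub>R x + lam *\<^sub>R T x"

definition enriched :: "('a::real_normed_vector \<Rightarrow> 'a) set \<Rightarrow> ('a \<Rightarrow> 'a) set" where
  "enriched C = {T. \<exists>lam::real. 0 < lam \<and> lam \<le> 1 \<and> averaged lam T \<in> C}"

definition unsaturated :: "('a::real_normed_vector \<Rightarrow> 'a) set \<Rightarrow> bool" where
  "unsaturated C \<longleftrightarrow> C \<subset> enriched C"

definition almost_contraction :: "('a::real_normed_vector \<Rightarrow> 'a) \<Rightarrow> bool" where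
  "almost_contraction T \<longleftrightarrow>
     (\<exists>\<delta> L::real. 0 < \<delta> \<and> \<delta> < 1 \<and> 0 \<le> L \<and>
        (\<forall>x y. norm (T x - T y) \<le> \<delta> * norm (x - y) + L * norm (y - T x)))"

definition almost_contractions :: "('a::real_normed_vector \<Rightarrow> 'a) set" where
  "almost_contractions = {T. almost_contraction T}"

end

theory Submission
  imports Defs
begin

text \<open>The reflection \<open>uminus\<close> witnesses strictness. It swaps \<open>v\<close> and
  \<open>- v\<close>, so it preserves their distance, whereas an almost contraction would have to
  shrink it (\<open>not_almost_contraction_uminus\<close>). Yet its average with the identity at
  equal weights sends each point to the midpoint of \<open>x\<close> and \<open>- x\<close>, which
  is always 0, and a constant map is an almost contraction
  (\<open>almost_contraction_const\<close>).\<close>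

lemma subset_enriched: "C \<subseteq> enriched C"
proof
  fix T assume "T \<in> C"
  moreover have "averaged 1 T = T"
    by (simp add: averaged_def fun_eq_iff)
  ultimately show "T \<in> enriched C"
    unfolding enriched_def by (intro CollectI exI[of _ 1]) simp
qed

lemma almost_contraction_const: "almost_contraction (\<lambda>x. c)"
  unfolding almost_contraction_def by (intro exI[of _ "1/2"] exI[of _ 0]) simp

lemma not_almost_contraction_uminus:
  assumes "(v :: 'a::real_normed_vector) \<noteq> 0"
  shows "\<not> almost_contraction (uminus :: 'a \<Rightarrow> 'a)"
proof
  assume "almost_contraction (uminus :: 'a \<Rightarrow> 'a)"
  then obtain \<delta> L :: real where "\<delta> < 1" and
    le: "\<And>x y :: 'a. norm (- x - - y) \<le> \<delta> * norm (x - y) + L * norm (y - - x)"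
    unfolding almost_contraction_def by blast
  \<comment> \<open>A period-two orbit is an obstruction: the term with \<open>L\<close> vanishes at \<open>y = T x\<close>.\<close>
  have "norm (v + v) \<le> \<delta> * norm (v + v)"
    using le[of "- v" v] by (simp add: norm_minus_commute[of "- v" v])
  moreover have "norm (v + v) > 0"
    using assms by (simp flip: scaleR_2)
  ultimately show False
    using \<open>\<delta> < 1\<close> by simp
qed

theorem proposition9:
  assumes nontrivial: "(UNIV :: 'a::banach set) \<noteq> {0}"
  shows "unsaturated (almost_contractions :: ('a \<Rightarrow> 'a) set)"
proof -
  \<comment> \<open>On the zero space the only self map is constant, so both classes coincide there;
    strictness needs a nonzero vector.\<close>
  obtain v :: 'a where "v \<noteq> 0"
    using nontrivial by blast
  then have "uminus \<notin> (almost_contractions :: ('a \<Rightarrow> 'a) set)"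
    using not_almost_contraction_uminus by (simp add: almost_contractions_def)
  moreover have "uminus \<in> enriched (almost_contractions :: ('a \<Rightarrow> 'a) set)"
  proof -
    \<comment> \<open>Averaging \<open>uminus\<close> with weight \<open>lam\<close> gives
      multiplication by \<open>1 - 2 * lam\<close>, which vanishes at 1/2.\<close>
    have "averaged (1/2) (uminus :: 'a \<Rightarrow> 'a) = (\<lambda>x. 0)"
      by (simp add: averaged_def fun_eq_iff)
    then have "averaged (1/2) (uminus :: 'a \<Rightarrow> 'a) \<in> almost_contractions"
      by (simp add: almost_contractions_def almost_contraction_const)
    then show ?thesis
      unfolding enriched_def by (intro CollectI exI[of _ "1/2"]) simp
  qed
  ultimately show ?thesis
    unfolding unsaturated_def using subset_enriched by blast
qed

end
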